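(* Let $Q$ be a standard tableau with at most two rows. Then $Q$ is the RSK recording tableau of some boolean permutation if and only if $\mathrm{Row}_2(Q)$ is uncrowded.
   Context: A standard tableau of size $n$ is a standard Young tableau filled with $1,\dots,n$ (rows increasing left to right, columns increasing top to bottom). A set $L$ of integers is uncrowded if $|[y,y+2x]\cap L|\le x+1$ for all integers $x,y$ with $x>0$. A word $i_1\cdots i_\ell$ is a reduced word of $w\in S_n$ if $w=s_{i_1}\cdots s_{i_\ell}$ with $\ell$ minimal, where $s_i$ is the adjacent transposition swapping $i$ and $i+1$. A permutation is boolean if some (equivalently, every) reduced word of it consists of distinct letters. Equivalently, it avoids the patterns $321$ and $3412$. The RSK recording tableau of $w$ is the tableau $Q(w)$ in the Robinson–Schensted–Knuth (row insertion) correspondence $w\mapsto(P(w),Q(w))$, and $\mathrm{Row}_2(T)$ is the set of entries in the second row of a tableau $T$ (empty if $T$ has only one row). *)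

theory Defs
  imports Main "HOL-Combinatorics.Permutations"
begin

text \<open>A tableau is the list of its rows, from top to bottom (English notation).\<close>

type_synonym tableau = "nat list list"

definition standard_tableau :: "nat \<Rightarrow> tableau \<Rightarrow> bool" where
  "standard_tableau n T \<longleftrightarrow>
     [] \<notin> set T \<and>
     sorted_wrt (\<ge>) (map length T) \<and>
     distinct (concat T) \<and> set (concat T) = {1..n} \<and>
     (\<forall>R\<in>set T. sorted_wrt (<) R) \<and>
     (\<forall>i j. Suc i < length T \<longrightarrow> j < length (T ! Suc i) \<longrightarrow> T ! i ! j < T ! Suc i ! j)"

definition Row2 :: "tableau \<Rightarrow> nat set" where
  "Row2 T = (if 2 \<le> length T then set (T ! 1) else {})"

definition uncrowded :: "int set \<Rightarrow> bool" where
  "uncrowded L \<longleftrightarrow> (\<forall>x y :: int. x > 0 \<longrightarrow> int (card ({y..y + 2 * x} \<inter> L)) \<le> x + 1)"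

text \<open>The product \<open>s\<^sub>i\<^sub>1 \<cdots> s\<^sub>i\<^sub>l\<close> is composition of functions; the opposite
  convention would replace the permutation by its inverse and reverse its reduced words.\<close>

definition word_perm :: "nat list \<Rightarrow> nat \<Rightarrow> nat" where
  "word_perm u = foldr (\<lambda>i f. Transposition.transpose i (Suc i) \<circ> f) u id"

definition reduced_word :: "nat \<Rightarrow> (nat \<Rightarrow> nat) \<Rightarrow> nat list \<Rightarrow> bool" where
  "reduced_word n w u \<longleftrightarrow>
     set u \<subseteq> {1..<n} \<and> w = word_perm u \<and>
     (\<forall>v. set v \<subseteq> {1..<n} \<longrightarrow> w = word_perm v \<longrightarrow> length u \<le> length v)"

definition boolean_perm :: "nat \<Rightarrow> (nat \<Rightarrow> nat) \<Rightarrow> bool" where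
  "boolean_perm n w \<longleftrightarrow> w permutes {1..n} \<and> (\<exists>u. reduced_word n w u \<and> distinct u)"

text \<open>Inserting into a row also returns the entry that is bumped out, if there is one.\<close>

fun row_insert :: "nat \<Rightarrow> nat list \<Rightarrow> nat list \<times> nat option" where
  "row_insert x [] = ([x], None)"
| "row_insert x (y # ys) =
     (if x < y then (x # ys, Some y)
      else (case row_insert x ys of (ys', b) \<Rightarrow> (y # ys', b)))"

text \<open>Inserting into a tableau also returns the index, counted from 0, of the row
  that gains a box.\<close>

fun tableau_insert :: "nat \<Rightarrow> tableau \<Rightarrow> tableau \<times> nat" where
  "tableau_insert x [] = ([[x]], 0)"
| "tableau_insert x (R # T) =
     (case row_insert x R of
        (R', None) \<Rightarrow> (R' # T, 0)
      | (R', Some y) \<Rightarrow> (case tableau_insert y T of (T', r) \<Rightarrow> (R' # T', Suc r)))"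

definition add_box :: "nat \<Rightarrow> nat \<Rightarrow> tableau \<Rightarrow> tableau" where
  "add_box k r T = (if r < length T then T[r := T ! r @ [k]] else T @ [[k]])"

definition RSK_step :: "nat \<times> nat \<Rightarrow> tableau \<times> tableau \<Rightarrow> tableau \<times> tableau" where
  "RSK_step = (\<lambda>(k, x) (P, Q). case tableau_insert x P of (P', r) \<Rightarrow> (P', add_box k r Q))"

definition RSK :: "nat \<Rightarrow> (nat \<Rightarrow> nat) \<Rightarrow> tableau \<times> tableau" where
  "RSK n w = fold RSK_step (map (\<lambda>k. (k, w k)) [1..<Suc n]) ([], [])"

definition recording_tableau :: "nat \<Rightarrow> (nat \<Rightarrow> nat) \<Rightarrow> tableau" where
  "recording_tableau n w = snd (RSK n w)"

end

theory Submission
  imports Defs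
begin

text \<open>
  Let \<open>w\<close> be the product of a word \<open>u\<close> with distinct letters. Since the letter \<open>k\<close> is the only one
  that moves anything across the gap between \<open>k\<close> and \<open>Suc k\<close>, the first \<open>k\<close> values of \<open>w\<close> are
  \<open>1, \<dots>, k\<close> if \<open>k\<close> does not occur in \<open>u\<close>; otherwise one value \<open>m \<le> k\<close> is missing and one value
  \<open>a > k\<close> overshoots. The next value \<open>w (Suc k)\<close> is then a new overshoot (a \<^emph>\<open>rise\<close>), or it is \<open>m\<close>, or,
  outside the support, it is \<open>Suc k\<close>. Which case occurs depends only on the support of \<open>u\<close> and on the
  relative order of the letters \<open>k\<close> and \<open>Suc k\<close> (lemmas \<open>value_at_rise\<close> and \<open>value_at_fall\<close>).

  Row insertion along \<open>w\<close> therefore needs only one number of memory, the number \<open>c\<close> of first-row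
  entries that exceed \<open>m\<close>. A rise appends to the first row and increases \<open>c\<close>. Inserting \<open>m\<close> bumps the
  smallest of these \<open>c\<close> entries into the second row if \<open>c > 0\<close>, and appends to the first row if
  \<open>c = 0\<close>. Afterwards \<open>Suc k\<close> is missing, so of the remaining entries only the overshoot still
  exceeds the missing value, and \<open>c\<close> becomes \<open>min 1 (c - 1)\<close>. When the support is left, \<open>c\<close> is reset to \<open>0\<close>. Thus
  the second row of the recording tableau consists of the positions that are not rises and are
  reached with \<open>c > 0\<close> (\<open>RSK_word_perm\<close>).

  The rest is counting. Give weight \<open>1\<close> to the elements of a set \<open>L\<close> and \<open>-1\<close> to the other positions;
  then \<open>L\<close> is uncrowded iff no window has weight \<open>3\<close> or more. If \<open>L\<close> is the second row of a recording tableau,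
  then \<open>c \<le> 1\<close> after a position in \<open>L\<close>, and from there on each further unit of weight costs at
  least one unit of \<open>c \<ge> 0\<close>, so that no window exceeds weight \<open>2\<close> (\<open>uncrowded_bumps\<close>). Conversely,
  given an uncrowded \<open>L\<close>, choose a word whose rises are exactly the positions before \<open>Max L\<close> that lie
  outside \<open>L\<close>. The only obstruction is to reach an element of \<open>L\<close> with \<open>c = 0\<close>. Going back to the
  last time that the cap \<open>1\<close> took effect one would find a window of weight \<open>3\<close>; and if it never took effect,
  the positions up to this one would have positive weight, against the column condition for a standard
  tableau (\<open>bumps_greedy\<close>).
\<close>

section \<open>Distinct words, seen through the prefixes of the permutation\<close>

lemma word_perm_simps [simp]:
  "word_perm [] = id"
  "word_perm (i # u) = Transposition.transpose i (Suc i) \<circ> word_perm u"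
  by (simp_all add: word_perm_def)

lemma word_perm_append: "word_perm (u @ v) = word_perm u \<circ> word_perm v"
  by (induction u) (simp_all add: comp_assoc)

lemma bij_word_perm: "bij (word_perm u)"
proof (induction u)
  case Nil
  show ?case by (simp only: word_perm_simps bij_id)
next
  case (Cons i u)
  then show ?case by (simp only: word_perm_simps bij_comp bij_transpose)
qed

lemma word_perm_permutes: "set u \<subseteq> {1..<n} \<Longrightarrow> word_perm u permutes {1..n}"
proof (induction u)
  case Nil
  show ?case by (simp only: word_perm_simps permutes_id)
next
  case (Cons i u)
  then show ?case
    by (auto simp del: comp_apply intro!: permutes_compose permutes_swap_id)
qed

lemma word_perm_image_atMost: "k \<notin> set u \<Longrightarrow> word_perm u ` {..k} = {..k}"
proof (induction u)
  case Nil
  then show ?case by simp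
next
  case (Cons i u)
  then have "Transposition.transpose i (Suc i) ` {..k} = {..k}"
    by (subst transpose_image_eq) auto
  with Cons show ?case by (simp add: image_comp [symmetric] del: comp_apply)
qed

lemma word_perm_fixes: "k \<notin> set u \<Longrightarrow> Suc k \<notin> set u \<Longrightarrow> word_perm u (Suc k) = Suc k"
  by (induction u) (auto simp: transpose_def)

text \<open>
  If the letter \<open>k\<close> occurs once in \<open>u\<close>, say \<open>u = v @ k # r\<close>, then neither \<open>v\<close> nor \<open>r\<close> moves anything
  across the gap between \<open>k\<close> and \<open>Suc k\<close>. So \<open>word_perm u\<close> sends \<open>{..k}\<close> to \<open>{..k}\<close> with the image of \<open>k\<close>
  under \<open>v\<close> exchanged for the image of \<open>Suc k\<close> under \<open>v\<close>. Here \<open>takeWhile\<close> extracts \<open>v\<close>.\<close>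

definition missing :: "nat list \<Rightarrow> nat \<Rightarrow> nat" where
  "missing u k = word_perm (takeWhile (\<lambda>i. i \<noteq> k) u) k"

definition overshoot :: "nat list \<Rightarrow> nat \<Rightarrow> nat" where
  "overshoot u k = word_perm (takeWhile (\<lambda>i. i \<noteq> k) u) (Suc k)"

text \<open>
  These are the positions at which \<open>word_perm u\<close> takes a value greater than the position. For
  \<open>k = 0\<close> the truncated \<open>k - 1\<close> is \<open>k\<close> itself, which does no harm for words without the letter \<open>0\<close>.\<close>

definition rises :: "nat list \<Rightarrow> nat set" where
  "rises u = {k \<in> set u. k - 1 \<in> set u \<longrightarrow> k - 1 \<in> set (takeWhile (\<lambda>i. i \<noteq> k) u)}"

lemma takeWhile_neq_append: "k \<notin> set v \<Longrightarrow> takeWhile (\<lambda>i. i \<noteq> k) (v @ k # r) = v"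
  by (induction v) auto

lemma missing_split: "k \<notin> set v \<Longrightarrow> missing (v @ k # r) k = word_perm v k"
  by (simp add: missing_def takeWhile_neq_append)

lemma overshoot_split: "k \<notin> set v \<Longrightarrow> overshoot (v @ k # r) k = word_perm v (Suc k)"
  by (simp add: overshoot_def takeWhile_neq_append)

lemma rises_split:
  "k \<notin> set v \<Longrightarrow> k \<in> rises (v @ k # r) \<longleftrightarrow> (k - 1 \<in> set (v @ k # r) \<longrightarrow> k - 1 \<in> set v)"
  by (simp add: rises_def takeWhile_neq_append)

lemma prefix_image:
  assumes "distinct u" "k \<in> set u"
  shows "word_perm u ` {..k} = insert (overshoot u k) ({..k} - {missing u k})"
    and "missing u k \<le> k" and "k < overshoot u k"
proof -
  obtain v r where u: "u = v @ k # r" using assms(2) by (meson split_list)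
  have kv: "k \<notin> set v" and kr: "k \<notin> set r" using assms(1) u by auto
  have inj: "inj (word_perm v)" using bij_word_perm bij_is_inj by blast
  have v: "word_perm v ` {..k} = {..k}" by (rule word_perm_image_atMost [OF kv])
  show "missing u k \<le> k"
    using v imageI [of k "{..k}" "word_perm v"] by (simp add: u missing_split kv)
  have "word_perm v (Suc k) \<notin> word_perm v ` {..k}"
    by (simp add: inj_image_mem_iff [OF inj])
  then show "k < overshoot u k"
    by (simp add: v u overshoot_split kv not_le)
  have swap: "Transposition.transpose k (Suc k) ` {..k} = insert (Suc k) ({..k} - {k})"
    by (auto simp: transpose_def image_iff)
  have "word_perm u ` {..k} = word_perm v ` Transposition.transpose k (Suc k) ` word_perm r ` {..k}"
    by (simp add: u word_perm_append image_image)
  also have "\<dots> = insert (word_perm v (Suc k)) (word_perm v ` {..k} - {word_perm v k})"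
    by (simp add: word_perm_image_atMost [OF kr] swap image_set_diff [OF inj])
  finally show "word_perm u ` {..k} = insert (overshoot u k) ({..k} - {missing u k})"
    by (simp add: u v overshoot_split missing_split kv)
qed

text \<open>
  The letter \<open>k\<close> is absent from the part \<open>r\<close> of \<open>u = v @ Suc k # r\<close>, hence \<open>r\<close> fixes \<open>Suc k\<close>, which
  the middle letter sends to \<open>Suc (Suc k)\<close>. This covers both \<open>k\<close> outside the support and \<open>k\<close> to the left
  of \<open>Suc k\<close>.\<close>

lemma value_at_rise:
  assumes "distinct u" "Suc k \<in> rises u"
  shows "word_perm u (Suc k) = overshoot u (Suc k)"
proof -
  obtain v r where u: "u = v @ Suc k # r"
    using assms(2) by (auto simp: rises_def dest: split_list)
  have kv: "Suc k \<notin> set v" and kr: "Suc k \<notin> set r" using assms(1) u by auto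
  have "k \<notin> set r" using assms kv by (auto simp: u rises_split)
  then show ?thesis
    using word_perm_fixes [OF _ kr] by (simp add: u overshoot_split kv word_perm_append)
qed

text \<open>
  Dually, the part \<open>r\<close> of \<open>u = v @ k # r\<close> fixes \<open>Suc k\<close>, which the middle letter sends to \<open>k\<close>. This covers
  both \<open>Suc k\<close> outside the support and \<open>Suc k\<close> to the left of \<open>k\<close>.\<close>

lemma value_at_fall:
  assumes "distinct u" "k \<in> set u" "Suc k \<notin> rises u"
  shows "word_perm u (Suc k) = missing u k"
proof -
  obtain v r where u: "u = v @ k # r" using assms(2) by (meson split_list)
  have kv: "k \<notin> set v" and kr: "k \<notin> set r" using assms(1) u by auto
  have "Suc k \<notin> set r"
  proof
    assume "Suc k \<in> set r"
    then obtain q s where r: "r = q @ Suc k # s" by (meson split_list)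
    have "Suc k \<notin> set (v @ k # q)" using assms(1) u r by auto
    then have "Suc k \<in> rises ((v @ k # q) @ Suc k # s)"
      by (subst rises_split) auto
    then show False using assms(3) u r by simp
  qed
  then show ?thesis
    using word_perm_fixes [OF kr] by (simp add: u missing_split kv word_perm_append)
qed

lemma rise_in_support:
  assumes "distinct u" "k \<in> set u" "Suc k \<in> rises u"
  shows "missing u (Suc k) = missing u k" and "overshoot u k = Suc k"
proof -
  obtain t r where u: "u = t @ Suc k # r"
    using assms(3) by (auto simp: rises_def dest: split_list)
  have kt: "Suc k \<notin> set t" using assms(1) u by auto
  have "k \<in> set t" using assms kt by (auto simp: u rises_split)
  then obtain v q where t: "t = v @ k # q" by (meson split_list)
  have kv: "k \<notin> set v" "Suc k \<notin> set v" and kq: "k \<notin> set q" "Suc k \<notin> set q"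
    using assms(1) u t by auto
  have u': "u = v @ k # (q @ Suc k # r)" by (simp add: u t)
  have "missing u (Suc k) = word_perm t (Suc k)" by (simp add: u missing_split kt)
  also have "\<dots> = word_perm v k"
    using word_perm_fixes [OF kq] by (simp add: t word_perm_append)
  also have "\<dots> = missing u k" by (simp only: u' missing_split [OF kv(1)])
  finally show "missing u (Suc k) = missing u k" .
  show "overshoot u k = Suc k"
    by (simp only: u' overshoot_split [OF kv(1)] word_perm_fixes [OF kv])
qed

lemma missing_new:
  assumes "distinct u" "Suc k \<in> set u" "k \<in> set u \<longrightarrow> Suc k \<notin> rises u"
  shows "missing u (Suc k) = Suc k"
proof -
  obtain v r where u: "u = v @ Suc k # r" using assms(2) by (meson split_list)
  have kv: "Suc k \<notin> set v" using assms(1) u by auto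
  have "k \<notin> set v" using assms(3) kv by (auto simp: u rises_split)
  then show ?thesis
    using word_perm_fixes [OF _ kv] by (simp add: u missing_split kv)
qed

lemma overshoot_at_fall:
  assumes "distinct u" "k \<in> set u" "Suc k \<in> set u" "Suc k \<notin> rises u"
  shows "overshoot u (Suc k) = overshoot u k"
proof -
  obtain v t where u: "u = v @ Suc k # t" using assms(3) by (meson split_list)
  have kv: "Suc k \<notin> set v" using assms(1) u by auto
  have "k \<notin> set v" using assms(4) kv by (auto simp: u rises_split)
  moreover have "k \<in> set t" using assms(2,4) kv by (auto simp: u rises_split)
  ultimately obtain q r where t: "t = q @ k # r" and kv': "k \<notin> set v" by (meson split_list)
  have kq: "k \<notin> set q" "Suc k \<notin> set q" using assms(1) u t by auto
  have u': "u = (v @ Suc k # q) @ k # r" by (simp add: u t)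
  have "overshoot u k = word_perm (v @ Suc k # q) (Suc k)"
    unfolding u' by (rule overshoot_split) (use kv' kq in auto)
  also have "\<dots> = word_perm v (Suc (Suc k))"
    using word_perm_fixes [OF kq] by (simp add: word_perm_append)
  also have "\<dots> = overshoot u (Suc k)" by (simp add: u overshoot_split kv)
  finally show ?thesis by simp
qed

text \<open>
  A word with distinct letters is reduced: a word lacking the letter \<open>k\<close> preserves \<open>{..k}\<close>, while a
  single occurrence of \<open>k\<close> prevents this. So every other word for the same permutation contains all
  letters of \<open>u\<close>, and is at least as long.\<close>

lemma boolean_word_perm:
  assumes "distinct u" "set u \<subseteq> {1..<n}"
  shows "boolean_perm n (word_perm u)"
proof -
  have minimal: "length u \<le> length v" if eq: "word_perm u = word_perm v" for v
  proof -
    have "set u \<subseteq> set v"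
    proof
      fix k assume k: "k \<in> set u"
      show "k \<in> set v"
      proof (rule ccontr)
        assume "k \<notin> set v"
        then have "word_perm u ` {..k} = {..k}" by (simp add: eq word_perm_image_atMost)
        with prefix_image [OF assms(1) k] have "overshoot u k \<in> {..k}" by blast
        with prefix_image(3) [OF assms(1) k] show False by simp
      qed
    qed
    then have "card (set u) \<le> card (set v)" by (simp add: card_mono)
    also have "\<dots> \<le> length v" by (rule card_length)
    finally show ?thesis using assms(1) by (simp add: distinct_card)
  qed
  have "reduced_word n (word_perm u) u"
    unfolding reduced_word_def using assms(2) by (intro conjI allI impI minimal) simp_all
  then show ?thesis
    unfolding boolean_perm_def using assms(1) word_perm_permutes [OF assms(2)]
    by (intro conjI exI [of _ u])
qed

section \<open>A counter for the entries that can still be bumped\<close>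

text \<open>
  For the set \<open>A\<close> of rises and the support \<open>S\<close> of a word, this counts the first-row entries greater
  than the missing value after \<open>k\<close> insertions. Truncated subtraction makes a fall at \<open>0\<close> stay at \<open>0\<close>.\<close>

primrec slack :: "nat set \<Rightarrow> nat set \<Rightarrow> nat \<Rightarrow> nat" where
  "slack A S 0 = 0"
| "slack A S (Suc k) =
     (if Suc k \<in> A then slack A S k + 1
      else if Suc k \<in> S then min 1 (slack A S k - 1) else 0)"

definition bumps :: "nat set \<Rightarrow> nat set \<Rightarrow> nat set" where
  "bumps A S = {Suc k |k. Suc k \<notin> A \<and> 0 < slack A S k}"

lemma Suc_in_bumps: "Suc k \<in> bumps A S \<longleftrightarrow> Suc k \<notin> A \<and> 0 < slack A S k"
  by (auto simp: bumps_def)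

lemma zero_notin_bumps: "0 \<notin> bumps A S"
  by (auto simp: bumps_def)

lemma card_Int_greaterThanAtMost_Suc:
  assumes "y \<le> k"
  shows "card (L \<inter> {y<..Suc k}) = card (L \<inter> {y<..k}) + (if Suc k \<in> L then 1 else 0)"
proof -
  have "{y<..Suc k} = insert (Suc k) {y<..k}" using assms by auto
  then show ?thesis by (auto simp: card_insert_if)
qed

text \<open>
  Each element of \<open>bumps A S\<close> lowers the slack by at least one, and every other position raises it
  by at most one.\<close>

lemma card_bumps_le:
  "y \<le> k \<Longrightarrow> 2 * card (bumps A S \<inter> {y<..k}) + slack A S k \<le> slack A S y + (k - y)"
proof (induction k rule: dec_induct)
  case base
  then show ?case by simp
next
  case (step k)
  then show ?case
    by (auto simp: card_Int_greaterThanAtMost_Suc Suc_in_bumps)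
qed

text \<open>
  It suffices to look at a window from its first element \<open>z\<close> of \<open>bumps A S\<close> on. The cap gives slack at most \<open>1\<close>
  at \<open>z\<close>, so \<open>card_bumps_le\<close> allows at most \<open>x\<close> further elements after \<open>z\<close>, and \<open>z\<close> itself makes \<open>x + 1\<close>.\<close>

lemma uncrowded_bumps: "uncrowded (int ` bumps A S)"
  unfolding uncrowded_def
proof (intro allI impI)
  fix x y :: int
  assume x: "x > 0"
  define L where "L = bumps A S"
  define K where "K = nat (y + 2 * x)"
  define W where "W = {j \<in> L. y \<le> int j \<and> int j \<le> y + 2 * x}"
  have fin: "finite W" by (rule finite_subset [of _ "{..K}"]) (auto simp: W_def K_def)
  have "{y..y + 2 * x} \<inter> int ` L = int ` W" by (auto simp: W_def)
  then have card: "card ({y..y + 2 * x} \<inter> int ` L) = card W" by (simp add: card_image)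
  have "int (card W) \<le> x + 1"
  proof (cases "W = {}")
    case True
    with x show ?thesis by simp
  next
    case False
    define z where "z = Min W"
    have z: "z \<in> W" using fin False by (simp add: z_def)
    then obtain j where j: "z = Suc j" "Suc j \<in> L"
      using zero_notin_bumps by (cases z) (auto simp: W_def L_def)
    have zK: "z \<le> K" "int K = y + 2 * x" "y \<le> int z" using z by (auto simp: W_def K_def)
    have "W \<subseteq> insert z (L \<inter> {z<..K})"
      using fin by (auto simp: W_def K_def z_def order.strict_iff_order)
    then have "card W \<le> card (insert z (L \<inter> {z<..K}))" by (intro card_mono) auto
    also have "\<dots> \<le> card (L \<inter> {z<..K}) + 1" by (simp add: card_insert_if)
    finally have "card W \<le> card (L \<inter> {z<..K}) + 1" .
    moreover have "2 * card (L \<inter> {z<..K}) \<le> slack A S z + (K - z)"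
      using card_bumps_le [OF zK(1), of A S] by (simp add: L_def)
    moreover have "slack A S z \<le> 1" using j by (simp add: L_def Suc_in_bumps)
    ultimately show ?thesis using zK by linarith
  qed
  then show "int (card ({y..y + 2 * x} \<inter> int ` bumps A S)) \<le> x + 1"
    using card by (simp add: L_def)
qed

lemma uncrowded_window:
  assumes "uncrowded (int ` L)" "x > 0"
  shows "card (L \<inter> {y..y + 2 * x}) \<le> x + 1"
proof -
  have "{int y..int y + 2 * int x} \<inter> int ` L = int ` (L \<inter> {y..y + 2 * x})" by auto
  then show ?thesis
    using assms unfolding uncrowded_def
    by (metis (no_types, opaque_lifting) card_image inj_on_of_nat of_nat_0_less_iff of_nat_1 of_nat_add of_nat_le_iff)
qed

text \<open>
  As long as every element of \<open>L\<close> is reached with positive slack, the slack changes by exactly \<open>-1\<close> on \<open>L\<close>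
  and \<open>1\<close> off \<open>L\<close>, except where the cap applies. So the slack \<open>c\<close> records the exact weight either of
  all positions so far, or of those since some \<open>y \<in> L\<close> after which it equalled \<open>1\<close>.\<close>

definition greedy_slack_inv :: "nat set \<Rightarrow> nat \<Rightarrow> nat \<Rightarrow> bool" where
  "greedy_slack_inv L k c \<longleftrightarrow>
     c + 2 * card (L \<inter> {0<..k}) = k \<or>
     (\<exists>y\<in>L. y \<le> k \<and> c + 2 * card (L \<inter> {y<..k}) = 1 + (k - y))"

text \<open>
  With slack \<open>0\<close> at a further element of \<open>L\<close>, the first alternative of the invariant makes the
  initial segment up to \<open>Suc k\<close> too heavy for \<open>ballot\<close>. The second one gives a window from \<open>y\<close> to
  \<open>Suc k\<close> of odd length \<open>2 * x + 1\<close> with \<open>x\<close> elements of \<open>L\<close> strictly inside and two at its ends.\<close>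

lemma greedy_slack_pos:
  assumes unc: "uncrowded (int ` L)"
    and ballot: "\<And>k. 2 * card (L \<inter> {0<..k}) \<le> k"
    and inv: "greedy_slack_inv L k c" and L: "Suc k \<in> L"
  shows "0 < c"
proof (rule ccontr)
  assume "\<not> 0 < c"
  with inv consider "2 * card (L \<inter> {0<..k}) = k"
    | y where "y \<in> L" "y \<le> k" "2 * card (L \<inter> {y<..k}) = 1 + (k - y)"
    unfolding greedy_slack_inv_def by auto
  then show False
  proof cases
    case 1
    with ballot [of "Suc k"] L show False by (simp add: card_Int_greaterThanAtMost_Suc)
  next
    case 2
    define x where "x = card (L \<inter> {y<..k})"
    have x: "y + 2 * x = Suc k" "x > 0" using 2 by (auto simp: x_def)
    have "L \<inter> {y..Suc k} = insert y (L \<inter> {y<..Suc k})" using 2 by auto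
    then have "card (L \<inter> {y..Suc k}) = x + 2"
      using 2 L by (simp add: card_Int_greaterThanAtMost_Suc x_def)
    with uncrowded_window [OF unc x(2), of y] x(1) show False by simp
  qed
qed

lemma greedy_slack_inv_step:
  shows "greedy_slack_inv L k c \<Longrightarrow> Suc k \<notin> L \<Longrightarrow> greedy_slack_inv L (Suc k) (Suc c)"
    and "greedy_slack_inv L k (Suc c) \<Longrightarrow> Suc k \<in> L \<Longrightarrow> greedy_slack_inv L (Suc k) c"
    and "Suc k \<in> L \<Longrightarrow> greedy_slack_inv L (Suc k) 1"
proof -
  show "greedy_slack_inv L (Suc k) (Suc c)" if inv: "greedy_slack_inv L k c" and L: "Suc k \<notin> L"
  proof (cases "c + 2 * card (L \<inter> {0<..k}) = k")
    case True
    with L show ?thesis by (simp add: greedy_slack_inv_def card_Int_greaterThanAtMost_Suc)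
  next
    case False
    with inv obtain y where "y \<in> L" "y \<le> k" "c + 2 * card (L \<inter> {y<..k}) = 1 + (k - y)"
      by (auto simp: greedy_slack_inv_def)
    with L show ?thesis unfolding greedy_slack_inv_def
      by (intro disjI2 bexI [of _ y]) (auto simp: card_Int_greaterThanAtMost_Suc)
  qed
  show "greedy_slack_inv L (Suc k) c" if inv: "greedy_slack_inv L k (Suc c)" and L: "Suc k \<in> L"
  proof (cases "Suc c + 2 * card (L \<inter> {0<..k}) = k")
    case True
    with L show ?thesis by (simp add: greedy_slack_inv_def card_Int_greaterThanAtMost_Suc)
  next
    case False
    with inv obtain y where "y \<in> L" "y \<le> k" "Suc c + 2 * card (L \<inter> {y<..k}) = 1 + (k - y)"
      by (auto simp: greedy_slack_inv_def)
    with L show ?thesis unfolding greedy_slack_inv_def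
      by (intro disjI2 bexI [of _ y]) (auto simp: card_Int_greaterThanAtMost_Suc)
  qed
  show "greedy_slack_inv L (Suc k) 1" if "Suc k \<in> L"
    using that by (auto simp: greedy_slack_inv_def)
qed

lemma greedy_slack:
  assumes unc: "uncrowded (int ` L)"
    and ballot: "\<And>k. 2 * card (L \<inter> {0<..k}) \<le> k"
  shows "k < M \<Longrightarrow> greedy_slack_inv L k (slack ({1..<M} - L) {1..<M} k)"
proof (induction k)
  case 0
  then show ?case by (simp add: greedy_slack_inv_def)
next
  case (Suc k)
  let ?c = "slack ({1..<M} - L) {1..<M} k"
  have inv: "greedy_slack_inv L k ?c" using Suc by simp
  show ?case
  proof (cases "Suc k \<in> L")
    case False
    then show ?thesis using greedy_slack_inv_step(1) [OF inv] Suc.prems by simp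
  next
    case True
    have "0 < ?c" by (rule greedy_slack_pos [OF unc ballot inv True])
    then obtain c where c: "?c = Suc c" by (cases ?c) auto
    have "greedy_slack_inv L (Suc k) (min 1 c)"
      using greedy_slack_inv_step(2) [OF inv [unfolded c] True] greedy_slack_inv_step(3) [OF True]
      by (simp add: min_def)
    then show ?thesis using True Suc.prems c by simp
  qed
qed

text \<open>
  Here \<open>M\<close> is the maximum of \<open>L\<close>, or \<open>0\<close> if \<open>L\<close> is empty. The support ends at \<open>M - 1\<close>, so
  the slack vanishes from \<open>M\<close> on and no further position enters the second row.\<close>

lemma bumps_greedy:
  assumes unc: "uncrowded (int ` L)"
    and ballot: "\<And>k. 2 * card (L \<inter> {0<..k}) \<le> k"
    and L: "L \<subseteq> {1..M}" "M = 0 \<or> M \<in> L"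
  shows "bumps ({1..<M} - L) {1..<M} = L"
proof -
  let ?c = "slack ({1..<M} - L) {1..<M}"
  have zero: "?c k = 0" if "M \<le> k" for k
    using that L(2) by (cases k) auto
  have "j \<in> bumps ({1..<M} - L) {1..<M} \<longleftrightarrow> j \<in> L" for j
  proof (cases j)
    case 0
    then show ?thesis using L(1) zero_notin_bumps by auto
  next
    case (Suc k)
    show ?thesis
    proof
      assume "j \<in> bumps ({1..<M} - L) {1..<M}"
      then have *: "Suc k \<notin> {1..<M} - L" "0 < ?c k" by (auto simp: Suc Suc_in_bumps)
      then have "k < M" using zero [of k] by (cases "k < M") auto
      then show "j \<in> L" using * L(2) Suc by (cases "Suc k = M") auto
    next
      assume j: "j \<in> L"
      then have "greedy_slack_inv L k (?c k)"
        using L(1) Suc by (intro greedy_slack [OF unc ballot]) auto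
      then have "0 < ?c k" using j Suc greedy_slack_pos [OF unc ballot] by blast
      then show "j \<in> bumps ({1..<M} - L) {1..<M}" using j by (auto simp: Suc Suc_in_bumps)
    qed
  qed
  then show ?thesis by blast
qed

section \<open>Row insertion along a distinct word\<close>

text \<open>
  This drops empty rows, which do not occur in tableaux. It is meant for an empty \<open>S\<close> whenever \<open>R\<close> is
  empty.\<close>

definition rows :: "nat list \<Rightarrow> nat list \<Rightarrow> tableau" where
  "rows R S = (if R = [] then [] else if S = [] then [R] else [R, S])"

lemma row_insert_append: "\<forall>z\<in>set R. z < x \<Longrightarrow> row_insert x R = (R @ [x], None)"
  by (induction R) auto

lemma row_insert_bump:
  "\<forall>z\<in>set X. z < x \<Longrightarrow> x < y \<Longrightarrow> row_insert x (X @ y # Y) = (X @ x # Y, Some y)"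
  by (induction X) auto

lemma tableau_insert_append:
  "\<forall>z\<in>set R. z < x \<Longrightarrow> (R = [] \<longrightarrow> S = []) \<Longrightarrow>
    tableau_insert x (rows R S) = (rows (R @ [x]) S, 0)"
  by (auto simp: rows_def row_insert_append)

lemma tableau_insert_bump:
  assumes "\<forall>z\<in>set X. z < x" "x < y" "\<forall>z\<in>set S. z < y"
  shows "tableau_insert x (rows (X @ y # Y) S) = (rows (X @ x # Y) (S @ [y]), 1)"
  using assms by (auto simp: rows_def row_insert_append row_insert_bump)

lemma add_box_rows_0: "(R = [] \<longrightarrow> S = []) \<Longrightarrow> add_box k 0 (rows R S) = rows (R @ [k]) S"
  by (auto simp: rows_def add_box_def)

lemma add_box_rows_1: "R \<noteq> [] \<Longrightarrow> add_box k 1 (rows R S) = rows R (S @ [k])"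
  by (auto simp: rows_def add_box_def)

lemma RSK_Suc: "RSK (Suc k) w = RSK_step (Suc k, w (Suc k)) (RSK k w)"
  by (simp add: RSK_def)

definition two_row_tableau :: "nat \<Rightarrow> nat set \<Rightarrow> tableau" where
  "two_row_tableau n L = rows (filter (\<lambda>i. i \<notin> L) [1..<Suc n]) (filter (\<lambda>i. i \<in> L) [1..<Suc n])"

text \<open>
  The invariant of row insertion after \<open>k\<close> steps, when the rows are \<open>X @ Y\<close> and \<open>S\<close>. The part \<open>Y\<close>
  holds the entries that exceed the missing value, so it is the part from which the next fall
  bumps. Entries of \<open>S\<close> lie below \<open>Y\<close>, which guarantees that a bumped entry goes to the end of the second
  row. Outside the support there is no missing value, and \<open>Y\<close> will be empty.\<close>

definition RSK_state :: "nat list \<Rightarrow> nat \<Rightarrow> nat list \<Rightarrow> nat list \<Rightarrow> nat list \<Rightarrow> bool" where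
  "RSK_state u k X Y S \<longleftrightarrow>
     sorted_wrt (<) (X @ Y) \<and>
     set X \<union> set Y \<union> set S \<subseteq> word_perm u ` {..k} \<and>
     (k \<in> set u \<longrightarrow>
        (\<forall>x\<in>set X. x < missing u k) \<and>
        (\<forall>y\<in>set Y. missing u k < y \<and> (\<forall>z\<in>set S. z < y)) \<and>
        (Y \<noteq> [] \<longrightarrow> last Y = overshoot u k))"

lemma slack_outside: "A \<subseteq> S \<Longrightarrow> k \<notin> S \<Longrightarrow> slack A S k = 0"
  by (cases k) auto

lemma rises_subset: "rises u \<subseteq> set u"
  by (auto simp: rises_def)

text \<open>
  All entries so far are at most \<open>Suc k\<close>, because the old overshoot, if there is one, equals \<open>Suc k\<close>;
  the new overshoot is therefore larger than all of them.\<close>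

lemma RSK_state_rise:
  assumes u: "distinct u" and st: "RSK_state u k X Y S"
    and closed: "k \<notin> set u \<Longrightarrow> Y = []" and rise: "Suc k \<in> rises u"
  shows "RSK_state u (Suc k) X (Y @ [word_perm u (Suc k)]) S"
    and "\<forall>z\<in>set (X @ Y). z < word_perm u (Suc k)"
proof -
  let ?a = "overshoot u (Suc k)"
  have mem: "Suc k \<in> set u" using rise rises_subset by blast
  have w: "word_perm u (Suc k) = ?a" by (rule value_at_rise [OF u rise])
  have a: "Suc k < ?a" by (rule prefix_image(3) [OF u mem])
  have img: "word_perm u ` {..k} \<subseteq> {..Suc k}"
  proof (cases "k \<in> set u")
    case True
    show ?thesis
      unfolding prefix_image(1) [OF u True] rise_in_support(2) [OF u True rise] by auto
  next
    case False
    show ?thesis unfolding word_perm_image_atMost [OF False] by auto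
  qed
  have sub: "set X \<union> set Y \<union> set S \<subseteq> word_perm u ` {..k}"
    using st by (simp add: RSK_state_def)
  then have "set X \<union> set Y \<union> set S \<subseteq> {..Suc k}" using img by (rule order.trans)
  then have less: "\<forall>z \<in> set X \<union> set Y \<union> set S. z < ?a" using a by fastforce
  then show "\<forall>z\<in>set (X @ Y). z < word_perm u (Suc k)" by (simp add: w)
  have below: "(\<forall>x\<in>set X. x < missing u (Suc k)) \<and>
      (\<forall>y\<in>set Y. missing u (Suc k) < y \<and> (\<forall>z\<in>set S. z < y))"
  proof (cases "k \<in> set u")
    case True
    with st show ?thesis
      by (simp add: RSK_state_def rise_in_support(1) [OF u True rise])
  next
    case False
    have "missing u (Suc k) = Suc k" using missing_new [OF u mem] False by simp
    moreover have "\<forall>x\<in>set X. x \<le> k" using sub unfolding word_perm_image_atMost [OF False] by auto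
    ultimately show ?thesis using closed [OF False] by (auto simp: less_Suc_eq_le)
  qed
  have "missing u (Suc k) < ?a" using prefix_image(2) [OF u mem] a by simp
  moreover have "sorted_wrt (<) (X @ Y @ [?a])"
    using st less by (auto simp: RSK_state_def sorted_wrt_append)
  moreover have "set X \<union> set (Y @ [?a]) \<union> set S \<subseteq> word_perm u ` {..Suc k}"
    using sub w by (auto simp: atMost_Suc)
  ultimately show "RSK_state u (Suc k) X (Y @ [word_perm u (Suc k)]) S"
    using below less by (simp add: RSK_state_def w)
qed

lemma RSK_state_fixed:
  assumes st: "RSK_state u k X [] S" and "k \<notin> set u" "Suc k \<notin> set u"
  shows "RSK_state u (Suc k) (X @ [word_perm u (Suc k)]) [] S"
    and "\<forall>z\<in>set X. z < word_perm u (Suc k)"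
  using assms word_perm_image_atMost [of k u] word_perm_fixes [of k u]
  by (force simp: RSK_state_def sorted_wrt_append atMost_Suc)+

lemma RSK_state_fall_append:
  assumes u: "distinct u" and st: "RSK_state u k X [] S"
    and k: "k \<in> set u" and fall: "Suc k \<notin> rises u"
  shows "RSK_state u (Suc k) (X @ [word_perm u (Suc k)]) [] S"
    and "\<forall>z\<in>set X. z < word_perm u (Suc k)"
proof -
  have w: "word_perm u (Suc k) = missing u k" by (rule value_at_fall [OF u k fall])
  have m: "missing u k \<le> k" by (rule prefix_image(2) [OF u k])
  show less: "\<forall>z\<in>set X. z < word_perm u (Suc k)"
    using st k by (simp add: RSK_state_def w)
  have "missing u (Suc k) = Suc k" if "Suc k \<in> set u"
    using missing_new [OF u that] fall by simp
  then show "RSK_state u (Suc k) (X @ [word_perm u (Suc k)]) [] S"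
    using st less m w by (fastforce simp: RSK_state_def sorted_wrt_append atMost_Suc)
qed

text \<open>
  After the fall the missing value is \<open>Suc k\<close>. The entries of \<open>Y\<close> other than the overshoot are values among
  \<open>{..k}\<close>, so they move over to \<open>X'\<close>, and only the overshoot stays in \<open>Y'\<close>: this is where the cap in
  \<open>slack\<close> comes from. If \<open>Suc k\<close> is outside the support, everything moves to \<open>X'\<close>.\<close>

lemma RSK_state_fall_bump:
  assumes u: "distinct u" and st: "RSK_state u k X (y # Y) S"
    and k: "k \<in> set u" and fall: "Suc k \<notin> rises u"
  shows "\<exists>X' Y'. X' @ Y' = X @ word_perm u (Suc k) # Y \<and>
      length Y' = (if Suc k \<in> set u then min 1 (length Y) else 0) \<and>
      RSK_state u (Suc k) X' Y' (S @ [y])"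
    and "\<forall>z\<in>set X. z < word_perm u (Suc k)" "word_perm u (Suc k) < y" "\<forall>z\<in>set S. z < y"
proof -
  let ?x = "word_perm u (Suc k)"
  have w: "?x = missing u k" by (rule value_at_fall [OF u k fall])
  have m: "missing u k \<le> k" by (rule prefix_image(2) [OF u k])
  show X: "\<forall>z\<in>set X. z < ?x" and y: "?x < y" and S: "\<forall>z\<in>set S. z < y"
    using st k by (auto simp: RSK_state_def w)
  have Y: "\<forall>z\<in>set Y. ?x < z \<and> y < z \<and> (\<forall>t\<in>set S. t < z)"
    and Ysort: "sorted_wrt (<) Y"
    using st k by (auto simp: RSK_state_def w sorted_wrt_append)
  have sorted: "sorted_wrt (<) (X @ ?x # Y)"
    using st X Y by (fastforce simp: RSK_state_def sorted_wrt_append)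
  have sub: "set X \<union> set Y \<union> set S \<union> {y, ?x} \<subseteq> word_perm u ` {..Suc k}"
    using st by (auto simp: RSK_state_def atMost_Suc)
  show "\<exists>X' Y'. X' @ Y' = X @ ?x # Y \<and>
      length Y' = (if Suc k \<in> set u then min 1 (length Y) else 0) \<and>
      RSK_state u (Suc k) X' Y' (S @ [y])"
  proof (cases "Suc k \<in> set u")
    case False
    then have "RSK_state u (Suc k) (X @ ?x # Y) [] (S @ [y])"
      using sorted sub by (simp add: RSK_state_def)
    then show ?thesis using False by - (rule exI [of _ "X @ ?x # Y"], rule exI [of _ "[]"], simp)
  next
    case mem: True
    have new: "missing u (Suc k) = Suc k" using missing_new [OF u mem] fall by simp
    show ?thesis
    proof (cases "Y = []")
      case True
      then have "RSK_state u (Suc k) (X @ [?x]) [] (S @ [y])"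
        using sorted sub new X w m by (fastforce simp: RSK_state_def)
      then show ?thesis using True by - (rule exI [of _ "X @ [?x]"], rule exI [of _ "[]"], simp)
    next
      case False
      let ?a = "overshoot u k"
      have "last Y = ?a" using st k False by (simp add: RSK_state_def)
      then obtain Z where Z: "Y = Z @ [?a]" using False by (metis append_butlast_last_id)
      have a: "Suc k < ?a" "?a = overshoot u (Suc k)"
        using prefix_image(3) [OF u mem] overshoot_at_fall [OF u k mem fall] by simp_all
      have "\<forall>z\<in>set Z. z < ?a" using Ysort by (simp add: Z sorted_wrt_append)
      moreover have "set Z \<subseteq> word_perm u ` {..k}"
        using st by (auto simp: RSK_state_def Z)
      ultimately have "\<forall>z\<in>set Z. z < Suc k"
        unfolding prefix_image(1) [OF u k] by fastforce
      then have "RSK_state u (Suc k) (X @ ?x # Z) [?a] (S @ [y])"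
        using sorted sub new X w m a Y by (fastforce simp: RSK_state_def Z)
      then show ?thesis using mem Z
        by - (rule exI [of _ "X @ ?x # Z"], rule exI [of _ "[?a]"], simp)
    qed
  qed
qed

text \<open>
  The equality of row lengths keeps the insertion and the recording tableau in step, so that both gain
  their new box in the same way when one of the rows is still empty.\<close>

lemma RSK_word_perm:
  assumes u: "distinct u" "0 \<notin> set u"
  defines "L \<equiv> bumps (rises u) (set u)"
  shows "\<exists>X Y S. RSK k (word_perm u) = (rows (X @ Y) S, two_row_tableau k L) \<and>
      RSK_state u k X Y S \<and> length Y = slack (rises u) (set u) k \<and>
      length (X @ Y) = length (filter (\<lambda>i. i \<notin> L) [1..<Suc k]) \<and>
      (X @ Y = [] \<longrightarrow> S = []) \<and>
      (filter (\<lambda>i. i \<notin> L) [1..<Suc k] = [] \<longrightarrow> filter (\<lambda>i. i \<in> L) [1..<Suc k] = [])"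
proof (induction k)
  case 0
  show ?case using u(2)
    by (intro exI [of _ "[]"]) (simp add: RSK_def two_row_tableau_def rows_def RSK_state_def)
next
  case (Suc k)
  let ?w = "word_perm u" and ?c = "slack (rises u) (set u)"
  let ?Q1 = "filter (\<lambda>i. i \<notin> L) [1..<Suc k]" and ?Q2 = "filter (\<lambda>i. i \<in> L) [1..<Suc k]"
  obtain X Y S where RSK: "RSK k ?w = (rows (X @ Y) S, two_row_tableau k L)"
    and st: "RSK_state u k X Y S" and Y: "length Y = ?c k"
    and len: "length (X @ Y) = length ?Q1" and ne: "X @ Y = [] \<longrightarrow> S = []"
    and Qne: "?Q1 = [] \<longrightarrow> ?Q2 = []"
    using Suc.IH by blast
  have closed: "Y = []" if "k \<notin> set u" using Y slack_outside [OF rises_subset that] by simp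
  have Suc_L: "Suc k \<in> L \<longleftrightarrow> Suc k \<notin> rises u \<and> Y \<noteq> []"
    by (simp add: L_def Suc_in_bumps Y [symmetric])
  have upt: "[1..<Suc (Suc k)] = [1..<Suc k] @ [Suc k]" by simp
  \<comment> \<open>the step common to rises, fixed points and falls with slack \<open>0\<close>, all of which append to the first row\<close>
  have append: ?case
    if nL: "Suc k \<notin> L" and st': "RSK_state u (Suc k) X' Y' S" and eq: "X' @ Y' = X @ Y @ [?w (Suc k)]"
      and c': "length Y' = ?c (Suc k)" and less: "\<forall>z\<in>set (X @ Y). z < ?w (Suc k)" for X' Y'
  proof -
    have "RSK (Suc k) ?w = (rows (X' @ Y') S, two_row_tableau (Suc k) L)"
      unfolding RSK_Suc RSK RSK_step_def two_row_tableau_def upt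
      using tableau_insert_append [OF less ne] add_box_rows_0 [OF Qne] nL eq by simp
    moreover have "length (X' @ Y') = length (filter (\<lambda>i. i \<notin> L) [1..<Suc (Suc k)])"
      unfolding eq upt using len nL by (simp del: upt_Suc)
    moreover have "X' @ Y' = [] \<longrightarrow> S = []" unfolding eq by simp
    moreover have "filter (\<lambda>i. i \<notin> L) [1..<Suc (Suc k)] \<noteq> []" unfolding upt using nL by simp
    ultimately show ?thesis using st' c' by blast
  qed
  show ?case
  proof (cases "Suc k \<in> rises u")
    case True
    then show ?thesis
      using RSK_state_rise [OF u(1) st closed True] Suc_L Y by (intro append) auto
  next
    case fall: False
    show ?thesis
    proof (cases "k \<in> set u")
      case False
      then have "Suc k \<notin> set u" using fall by (auto simp: rises_def)
      then show ?thesis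
        using RSK_state_fixed [of u k X S] st closed [OF False] False fall Suc_L
        by (intro append [of "X @ [?w (Suc k)]" "[]"]) auto
    next
      case k: True
      show ?thesis
      proof (cases Y)
        case Nil
        then show ?thesis
          using RSK_state_fall_append [OF u(1) st [unfolded Nil] k fall] Suc_L Y fall
          by (intro append [of "X @ [?w (Suc k)]" "[]"]) auto
      next
        case (Cons y Z)
        note bump = RSK_state_fall_bump [OF u(1) st [unfolded Cons] k fall]
        obtain X' Y' where eq: "X' @ Y' = X @ ?w (Suc k) # Z"
          and c': "length Y' = (if Suc k \<in> set u then min 1 (length Z) else 0)"
          and st': "RSK_state u (Suc k) X' Y' (S @ [y])"
          using bump(1) by blast
        have L: "Suc k \<in> L" using fall Suc_L Cons by simp
        have Q1: "?Q1 \<noteq> []" using len Cons by (auto simp del: upt_Suc)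
        have "RSK (Suc k) ?w = (rows (X' @ Y') (S @ [y]), two_row_tableau (Suc k) L)"
          unfolding RSK_Suc RSK RSK_step_def two_row_tableau_def upt Cons
          using tableau_insert_bump [OF bump(2-4)] add_box_rows_1 [OF Q1] L eq by simp
        moreover have "length (X' @ Y') = length (filter (\<lambda>i. i \<notin> L) [1..<Suc (Suc k)])"
          unfolding eq upt using len L by (simp add: Cons del: upt_Suc)
        moreover have "length Y' = ?c (Suc k)" unfolding c' using fall Y [symmetric] Cons by simp
        moreover have "X' @ Y' \<noteq> []" unfolding eq by simp
        moreover have "filter (\<lambda>i. i \<notin> L) [1..<Suc (Suc k)] \<noteq> []" unfolding upt using Q1 by simp
        ultimately show ?thesis using st' by blast
      qed
    qed
  qed
qed

lemma recording_tableau_word_perm: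
  assumes "distinct u" "0 \<notin> set u"
  shows "recording_tableau n (word_perm u) = two_row_tableau n (bumps (rises u) (set u))"
  using RSK_word_perm [OF assms, of n] by (auto simp: recording_tableau_def)

lemma Row2_recording_tableau:
  assumes "distinct u" "set u \<subseteq> {1..<n}"
  shows "Row2 (recording_tableau n (word_perm u)) = bumps (rises u) (set u)"
proof -
  let ?L = "bumps (rises u) (set u)"
  have u0: "0 \<notin> set u" using assms(2) by auto
  have L: "?L \<subseteq> {1..n}"
  proof
    fix j assume "j \<in> ?L"
    then obtain k where k: "j = Suc k" "0 < slack (rises u) (set u) k"
      by (auto simp: bumps_def)
    then have "k \<in> set u" using slack_outside [OF rises_subset, of k u] by auto
    then show "j \<in> {1..n}" using k assms(2) by auto
  qed
  have "Row2 (rows R S) = set S" if "R = [] \<longrightarrow> S = []" for R S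
    using that by (auto simp: Row2_def rows_def)
  then have "Row2 (two_row_tableau n ?L) = set (filter (\<lambda>i. i \<in> ?L) [1..<Suc n])"
    unfolding two_row_tableau_def using RSK_word_perm [OF assms(1) u0, of n] by blast
  also have "\<dots> = ?L" using L by auto
  finally show ?thesis by (simp add: recording_tableau_word_perm [OF assms(1) u0])
qed

section \<open>Realising an uncrowded second row\<close>

text \<open>
  Appending the new letter \<open>Suc k\<close> on the right makes it a rise; prepending it puts it to the left of
  \<open>k\<close>, which makes it a fall if \<open>k > 0\<close>. The letter \<open>1\<close> is a rise in any case.\<close>

primrec greedy_word :: "nat set \<Rightarrow> nat \<Rightarrow> nat list" where
  "greedy_word L 0 = []"
| "greedy_word L (Suc k) =
     (if Suc k \<in> L then Suc k # greedy_word L k else greedy_word L k @ [Suc k])"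

lemma set_greedy_word: "set (greedy_word L k) = {1..k}"
  by (induction k) (auto simp: atLeastAtMostSuc_conv)

lemma distinct_greedy_word: "distinct (greedy_word L k)"
  by (induction k) (auto simp: set_greedy_word)

lemma rises_greedy_word:
  assumes "1 \<notin> L"
  shows "rises (greedy_word L k) = {1..k} - L"
proof (induction k)
  case 0
  then show ?case by (simp add: rises_def)
next
  case (Suc k)
  let ?g = "greedy_word L k"
  have iff: "j \<in> rises (greedy_word L (Suc k)) \<longleftrightarrow> j \<in> {1..Suc k} - L" for j
  proof (cases "j = Suc k")
    case True
    have "Suc k \<notin> set ?g" by (simp add: set_greedy_word)
    then have "takeWhile (\<lambda>i. i \<noteq> Suc k) (?g @ [Suc k]) = ?g"
      by (rule takeWhile_neq_append)
    then show ?thesis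
      using True assms by (cases k) (auto simp: rises_def set_greedy_word)
  next
    case False
    have "j \<in> rises (greedy_word L (Suc k)) \<longleftrightarrow> j \<in> rises ?g"
    proof (cases "j \<in> {1..k}")
      case True
      then have "j \<in> set ?g" by (simp add: set_greedy_word)
      then have "takeWhile (\<lambda>i. i \<noteq> j) (?g @ [Suc k]) = takeWhile (\<lambda>i. i \<noteq> j) ?g"
        by (intro takeWhile_append1) auto
      then show ?thesis using True by (auto simp: rises_def set_greedy_word)
    next
      case outside: False
      then show ?thesis
        using False rises_subset [of ?g] rises_subset [of "greedy_word L (Suc k)"]
        unfolding set_greedy_word by auto
    qed
    then show ?thesis using Suc.IH False by auto
  qed
  then show ?case by blast
qed

text \<open>
  Its second row determines a two-row standard tableau. The last claim is the ballot condition: each second-row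
  entry that is at most \<open>k\<close> has a smaller first-row entry directly above it in its column.\<close>

lemma standard_two_row_tableau:
  assumes Q: "standard_tableau n Q" and "length Q \<le> 2"
  shows "Q = two_row_tableau n (Row2 Q)" and "Row2 Q \<subseteq> {1..n}"
    and "2 * card (Row2 Q \<inter> {0<..k}) \<le> k"
proof -
  consider "Q = []" | R where "Q = [R]" | R S where "Q = [R, S]"
    using assms(2) by (auto simp: numeral_2_eq_2 le_Suc_eq length_Suc_conv)
  then obtain R S where QR: "Q = rows R S" and RS: "length S \<le> length R"
  proof cases
    case 1
    then show ?thesis using that [of "[]" "[]"] by (simp add: rows_def)
  next
    case (2 R)
    then show ?thesis using Q that [of R "[]"] by (auto simp: rows_def standard_tableau_def)
  next
    case (3 R S)
    then show ?thesis using Q that [of R S] by (auto simp: rows_def standard_tableau_def)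
  qed
  have Row2: "Row2 Q = set S" using RS by (auto simp: QR rows_def Row2_def)
  have concat: "concat Q = R @ S" using RS by (auto simp: QR rows_def)
  have sets: "set R \<union> set S = {1..n}" "set R \<inter> set S = {}"
    using Q concat by (auto simp: standard_tableau_def)
  then have setR: "set R = {1..n} - set S" and setS: "set S \<subseteq> {1..n}" by auto
  have sorted: "sorted_wrt (<) R" "sorted_wrt (<) S"
    using Q RS by (auto simp: standard_tableau_def QR rows_def split: if_splits)
  have column: "R ! j < S ! j" if "j < length S" for j
    using Q RS that by (auto simp: standard_tableau_def QR rows_def split: if_splits)
  show "Row2 Q \<subseteq> {1..n}" using sets Row2 by auto
  have R: "R = filter (\<lambda>i. i \<notin> set S) [1..<Suc n]"
    by (rule strict_sorted_equal [OF _ sorted(1)])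
      (auto simp: setR intro!: sorted_wrt_filter simp del: upt_Suc)
  have S: "S = filter (\<lambda>i. i \<in> set S) [1..<Suc n]"
    by (rule strict_sorted_equal [OF _ sorted(2)])
      (use setS in \<open>auto intro!: sorted_wrt_filter simp del: upt_Suc\<close>)
  show "Q = two_row_tableau n (Row2 Q)"
    unfolding two_row_tableau_def Row2 R [symmetric] S [symmetric] by (rule QR)
  have dist: "distinct R" "distinct S" using sorted strict_sorted_iff by auto
  have count: "card (set T \<inter> {0<..k}) = card {j. j < length T \<and> T ! j \<le> k}"
    if "distinct T" "set T \<subseteq> {1..n}" for T
  proof -
    have "set T \<inter> {0<..k} = (!) T ` {j. j < length T \<and> T ! j \<le> k}"
      using that(2) by (fastforce simp: in_set_conv_nth subset_iff)
    then show ?thesis using that(1) by (simp add: card_image inj_on_def nth_eq_iff_index_eq)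
  qed
  have "card (set S \<inter> {0<..k}) \<le> card (set R \<inter> {0<..k})"
    unfolding count [OF dist(2), unfolded sets(1) [symmetric], OF Un_upper2]
      count [OF dist(1), unfolded sets(1) [symmetric], OF Un_upper1]
    using RS column by (intro card_mono) (auto intro: less_imp_le order.trans)
  moreover have "card (set R \<inter> {0<..k}) + card (set S \<inter> {0<..k})
      = card (set R \<inter> {0<..k} \<union> set S \<inter> {0<..k})"
    using sets(2) by (intro card_Un_disjoint [symmetric]) auto
  moreover have "\<dots> \<le> card {0<..k}" by (intro card_mono) auto
  ultimately show "2 * card (Row2 Q \<inter> {0<..k}) \<le> k" by (simp add: Row2)
qed

theorem corollary5p6:
  fixes n :: nat and Q :: tableau
  assumes "standard_tableau n Q" and "length Q \<le> 2"
  shows "(\<exists>w. boolean_perm n w \<and> recording_tableau n w = Q) \<longleftrightarrow> uncrowded (int ` Row2 Q)"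
proof
  assume "\<exists>w. boolean_perm n w \<and> recording_tableau n w = Q"
  then obtain w u where "reduced_word n w u" "distinct u" "recording_tableau n w = Q"
    unfolding boolean_perm_def by blast
  then have u: "distinct u" "set u \<subseteq> {1..<n}" and Q: "recording_tableau n (word_perm u) = Q"
    unfolding reduced_word_def by blast+
  show "uncrowded (int ` Row2 Q)"
    unfolding Q [symmetric] Row2_recording_tableau [OF u] by (rule uncrowded_bumps)
next
  assume unc: "uncrowded (int ` Row2 Q)"
  define L where "L = Row2 Q"
  define M where "M = (if L = {} then 0 else Max L)"
  define u where "u = greedy_word L (M - 1)"
  note Q = standard_two_row_tableau [OF assms, folded L_def]
  have fin: "finite L" using Q(2) finite_subset by blast
  have M_cases: "M = 0 \<or> M \<in> L" using fin by (simp add: M_def)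
  have L_M: "L \<subseteq> {1..M}"
  proof
    fix j assume j: "j \<in> L"
    then have "L \<noteq> {}" by blast
    then have "j \<le> M" using fin j by (simp add: M_def)
    moreover have "1 \<le> j" using Q(2) j by (meson atLeastAtMost_iff subsetD)
    ultimately show "j \<in> {1..M}" by simp
  qed
  have M_n: "M \<le> n"
    using M_cases
  proof
    assume "M \<in> L"
    with Q(2) have "M \<in> {1..n}" by (rule subsetD)
    then show ?thesis by simp
  qed simp
  have one: "1 \<notin> L"
  proof
    assume "1 \<in> L"
    then have "L \<inter> {0<..1} = {1}" by auto
    then show False using Q(3) [of 1] by (simp only: card.empty card.insert) simp
  qed
  have "{1..M - 1} = {1..<M}" by auto
  then have u: "set u = {1..<M}" "rises u = {1..<M} - L" "distinct u"
    by (simp_all only: u_def set_greedy_word rises_greedy_word [OF one] distinct_greedy_word)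
  have "bumps (rises u) (set u) = L"
    unfolding u using bumps_greedy [OF unc [folded L_def] Q(3) L_M M_cases] .
  moreover have "0 \<notin> set u" by (simp add: u)
  ultimately have "recording_tableau n (word_perm u) = Q"
    using recording_tableau_word_perm [OF u(3)] Q(1) by metis
  moreover have "boolean_perm n (word_perm u)"
    using u(1,3) M_n by (intro boolean_word_perm) auto
  ultimately show "\<exists>w. boolean_perm n w \<and> recording_tableau n w = Q" by blast
qed

end
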